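(* Let $V$ be a finite set. Let $(K_t)_{t\ge1}$ be a sequence of irreducible aperiodic Markov transition operators on $V$ and $(\pi_t)_{t\ge1}$ a sequence of positive measures such that $\{(K_t,\pi_t)\}_{t\ge1}$ is a finite non-decreasing environment. Let $Q_t=K_t^*K_t$, where $K_t^*$ is the adjoint of $K_t$ on $\ell^2(\tilde\pi_t)$. Let $T\ge1$ and $C,D>0$. Assume that for all $t\ge1$ the pair $(Q_t,\tilde\pi_t)$ satisfies the $\mathcal N(C,D,T)$ Nash inequality, and that $\pi_1(V)\ge1$. Then for all integers $0\le r\le t\le T$, $$\left\|K_{r,t}-\tilde\pi_r(K_{r,t}\,\cdot)\right\|_{\ell^1(\tilde\pi_t)\to\ell^2(\tilde\pi_r)}\le\left(\frac{C\,2^{1/D}(1+1/T)(1+\lceil4D\rceil)}{t-r+1}\right)^D\frac{\pi_t(V)}{\sqrt{\pi_r(V)}},$$ and $$\left\|K_{r,t}-\tilde\pi_r(K_{r,t}\,\cdot)\right\|_{\ell^2(\tilde\pi_t)\to\ell^\infty(\tilde\pi_r)}\le2\left(\frac{4C\,2^{1/D}(1+1/T)(1+\lceil4D\rceil)}{t-r+1}\right)^D\sqrt{\pi_t(V)}.$$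
   Context: A Markov transition operator $K$ on $V$ is a map $K:V\times V\to[0,1]$ with $\sum_y K(x,y)=1$ for all $x$; it acts on functions by $(Kf)(x)=\sum_y K(x,y)f(y)$ and on measures by $(\mu K)(y)=\sum_x\mu(x)K(x,y)$. For $0\le r<t$, $K_{r,t}=K_{r+1}\cdots K_t$, and $K_{t,t}=I$; by convention $\pi_0:=\pi_1$. The operator $K_{r,t}-\tilde\pi_r(K_{r,t}\,\cdot)$ is $f\mapsto K_{r,t}f-\tilde\pi_r(K_{r,t}f)$. Finite non-decreasing environment: the $\pi_t$ are positive measures ($\pi_t(x)>0$ for all $x$) with, for all $t\ge1$: $\pi_tK_t=\pi_t$; $\pi_t(V)<+\infty$; $\pi_{t+1}(x)\ge\pi_t(x)$ for all $x\in V$. For a finite measure $\pi$, $\tilde\pi:=\pi/\pi(V)$ and $\tilde\pi(f)=\sum_xf(x)\tilde\pi(x)$. $\|f\|_{\ell^p(\tilde\pi)}=(\sum_x|f(x)|^p\tilde\pi(x))^{1/p}$, $\|f\|_{\ell^\infty}=\sup_x|f(x)|$. Dirichlet form: $\mathcal E_{Q,\tilde\pi}(f,f)=\langle(I-Q)f,f\rangle_{\tilde\pi}=\frac12\sum_{x,y}(f(x)-f(y))^2\tilde\pi(x)Q(x,y)$. Nash inequality: $(Q,\tilde\pi)$ satisfies the $\mathcal N(C,D,T)$ Nash inequality if for all $f:V\to\mathbb R$, $$\|f\|_{\ell^2(\tilde\pi)}^{2+1/D}\le C\left(\mathcal E_{Q,\tilde\pi}(f,f)+\frac1T\|f\|^2_{\ell^2(\tilde\pi)}\right)\|f\|_{\ell^1(\tilde\pi)}^{1/D}.$$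 *)

theory Defs
  imports "HOL-Analysis.Analysis"
begin

text \<open>
  The finite set \<open>V\<close> is the universe of a type \<open>'v\<close> of class \<open>finite\<close>.  Functions on \<open>V\<close> and
  measures on \<open>V\<close> are vectors \<open>real ^ 'v\<close>, kernels on \<open>V\<close> are matrices \<open>real ^ 'v ^ 'v\<close> with
  entries \<open>K $ x $ y\<close>.  Hence \<open>K f\<close> is \<open>K *v f\<close>, \<open>\<mu> K\<close> is \<open>\<mu> v* K\<close>, composition of kernels
  is \<open>**\<close> and the identity is \<open>mat 1\<close>.
\<close>

definition markov_operator :: "real ^ 'v ^ 'v \<Rightarrow> bool" where
  "markov_operator K \<longleftrightarrow>
     (\<forall>x y. 0 \<le> K $ x $ y \<and> K $ x $ y \<le> 1) \<and> (\<forall>x. (\<Sum>y\<in>UNIV. K $ x $ y) = 1)"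

text \<open>The power notation on \<open>real ^ 'v ^ 'v\<close> is componentwise, so matrix powers are iterated products.\<close>

definition kernel_power :: "real ^ 'v ^ 'v \<Rightarrow> nat \<Rightarrow> real ^ 'v ^ 'v" where
  "kernel_power K n = (((**) K) ^^ n) (mat 1)"

definition irreducible_kernel :: "real ^ 'v ^ 'v \<Rightarrow> bool" where
  "irreducible_kernel K \<longleftrightarrow> (\<forall>x y. \<exists>n. kernel_power K n $ x $ y > 0)"

definition aperiodic_kernel :: "real ^ 'v ^ 'v \<Rightarrow> bool" where
  "aperiodic_kernel K \<longleftrightarrow> (\<forall>x. Gcd {n. n \<ge> 1 \<and> kernel_power K n $ x $ x > 0} = (1::nat))"

text \<open>\<open>K_between K r t\<close> is \<open>K (r+1) ** \<dots> ** K t\<close>; the list is empty for \<open>t = r\<close>.\<close>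

definition K_between :: "(nat \<Rightarrow> real ^ 'v ^ 'v) \<Rightarrow> nat \<Rightarrow> nat \<Rightarrow> real ^ 'v ^ 'v" where
  "K_between K r t = foldr (**) (map K [Suc r..<Suc t]) (mat 1)"

definition mass :: "real ^ 'v \<Rightarrow> real" where
  "mass \<mu> = (\<Sum>x\<in>UNIV. \<mu> $ x)"

definition normalized :: "real ^ 'v \<Rightarrow> real ^ 'v" where
  "normalized \<mu> = (\<chi> x. \<mu> $ x / mass \<mu>)"

definition expect :: "real ^ 'v \<Rightarrow> real ^ 'v \<Rightarrow> real" where
  "expect \<mu> f = (\<Sum>x\<in>UNIV. f $ x * \<mu> $ x)"

definition lp_norm :: "real \<Rightarrow> real ^ 'v \<Rightarrow> real ^ 'v \<Rightarrow> real" where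
  "lp_norm p \<mu> f = (\<Sum>x\<in>UNIV. \<bar>f $ x\<bar> powr p * \<mu> $ x) powr (1 / p)"

definition linf_norm :: "real ^ 'v \<Rightarrow> real" where
  "linf_norm f = (SUP x. \<bar>f $ x\<bar>)"

definition l2_inner :: "real ^ 'v \<Rightarrow> real ^ 'v \<Rightarrow> real ^ 'v \<Rightarrow> real" where
  "l2_inner \<mu> f g = (\<Sum>x\<in>UNIV. f $ x * g $ x * \<mu> $ x)"

text \<open>Norm of an operator from the norm \<open>N\<close> to the norm \<open>M\<close>, as an extended real supremum, so that
  an unbounded operator has norm \<open>\<infinity>\<close>.\<close>

definition op_norm ::
    "(real ^ 'v \<Rightarrow> real) \<Rightarrow> (real ^ 'v \<Rightarrow> real) \<Rightarrow> (real ^ 'v \<Rightarrow> real ^ 'v) \<Rightarrow> ereal" where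
  "op_norm N M A = (SUP f\<in>{f. N f \<le> 1}. ereal (M (A f)))"

definition l2_adjoint :: "real ^ 'v \<Rightarrow> real ^ 'v ^ 'v \<Rightarrow> real ^ 'v ^ 'v" where
  "l2_adjoint \<mu> K = (THE L. \<forall>f g. l2_inner \<mu> (K *v f) g = l2_inner \<mu> f (L *v g))"

text \<open>For a positive \<open>\<mu>\<close> the adjoint exists and is unique, so the description is proper.\<close>

lemma l2_adjoint_eq:
  fixes K :: "real ^ 'v ^ 'v"
  assumes pos: "\<And>x. \<mu> $ x > 0"
  shows "l2_adjoint \<mu> K = (\<chi> x y. \<mu> $ y * K $ y $ x / \<mu> $ x)"
  unfolding l2_adjoint_def
proof (rule the_equality)
  show "\<forall>f g. l2_inner \<mu> (K *v f) g = l2_inner \<mu> f ((\<chi> x y. \<mu> $ y * K $ y $ x / \<mu> $ x) *v g)"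
  proof (intro allI)
    fix f g :: "real ^ 'v"
    have "l2_inner \<mu> (K *v f) g = (\<Sum>y\<in>UNIV. \<Sum>x\<in>UNIV. K $ y $ x * f $ x * g $ y * \<mu> $ y)"
      by (simp add: l2_inner_def matrix_vector_mult_def sum_distrib_right)
    also have "\<dots> = (\<Sum>x\<in>UNIV. \<Sum>y\<in>UNIV. K $ y $ x * f $ x * g $ y * \<mu> $ y)"
      by (rule sum.swap)
    also have "\<dots> = l2_inner \<mu> f ((\<chi> x y. \<mu> $ y * K $ y $ x / \<mu> $ x) *v g)"
      using pos by (simp add: l2_inner_def matrix_vector_mult_def sum_distrib_right
          sum_distrib_left less_imp_neq[OF pos, symmetric] mult_ac)
    finally show "l2_inner \<mu> (K *v f) g = \<dots>" .
  qed
next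
  fix L :: "real ^ 'v ^ 'v"
  assume L: "\<forall>f g. l2_inner \<mu> (K *v f) g = l2_inner \<mu> f (L *v g)"
  have "L $ x $ y = \<mu> $ y * K $ y $ x / \<mu> $ x" for x y
  proof -
    have "l2_inner \<mu> (K *v axis x 1) (axis y 1) = K $ y $ x * \<mu> $ y"
      by (simp add: l2_inner_def matrix_vector_mult_basis column_def)
         (simp add: axis_def if_distrib if_distribR cong: if_cong)
    moreover have "l2_inner \<mu> (axis x 1) (L *v axis y 1) = L $ x $ y * \<mu> $ x"
      by (simp add: l2_inner_def matrix_vector_mult_basis column_def)
         (simp add: axis_def if_distrib if_distribR cong: if_cong)
    ultimately have "L $ x $ y * \<mu> $ x = K $ y $ x * \<mu> $ y"
      using L by metis
    then show ?thesis
      using pos[of x] by (simp add: field_simps)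
  qed
  then show "L = (\<chi> x y. \<mu> $ y * K $ y $ x / \<mu> $ x)"
    by (simp add: vec_eq_iff)
qed

definition dirichlet_form :: "real ^ 'v ^ 'v \<Rightarrow> real ^ 'v \<Rightarrow> real ^ 'v \<Rightarrow> real" where
  "dirichlet_form Q \<mu> f = l2_inner \<mu> (f - Q *v f) f"

text \<open>The usual symmetrised expression, valid whenever \<open>\<mu>\<close> is invariant.\<close>

lemma dirichlet_form_eq:
  fixes Q :: "real ^ 'v ^ 'v"
  assumes row: "\<And>x. (\<Sum>y\<in>UNIV. Q $ x $ y) = 1" and inv: "\<mu> v* Q = \<mu>"
  shows "dirichlet_form Q \<mu> f =
    1 / 2 * (\<Sum>x\<in>UNIV. \<Sum>y\<in>UNIV. (f $ x - f $ y)\<^sup>2 * \<mu> $ x * Q $ x $ y)"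
proof -
  let ?S = "\<lambda>h. \<Sum>x\<in>UNIV. \<Sum>y\<in>UNIV. h x y * \<mu> $ x * Q $ x $ y"
  have a: "?S (\<lambda>x y. (f $ x)\<^sup>2) = (\<Sum>x\<in>UNIV. (f $ x)\<^sup>2 * \<mu> $ x)"
    by (simp add: row flip: sum_distrib_left)
  have col: "(\<Sum>x\<in>UNIV. \<mu> $ x * Q $ x $ y) = \<mu> $ y" for y
    using arg_cong[OF inv, of "\<lambda>v. v $ y"] by (simp add: vector_matrix_mult_def mult.commute)
  have "?S (\<lambda>x y. (f $ y)\<^sup>2) = (\<Sum>y\<in>UNIV. (f $ y)\<^sup>2 * (\<Sum>x\<in>UNIV. \<mu> $ x * Q $ x $ y))"
    by (subst sum.swap) (simp add: sum_distrib_left mult.assoc)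
  then have b: "?S (\<lambda>x y. (f $ y)\<^sup>2) = (\<Sum>x\<in>UNIV. (f $ x)\<^sup>2 * \<mu> $ x)"
    by (simp only: col)
  have "?S (\<lambda>x y. (f $ x - f $ y)\<^sup>2) =
      ?S (\<lambda>x y. (f $ x)\<^sup>2) + ?S (\<lambda>x y. (f $ y)\<^sup>2) - 2 * ?S (\<lambda>x y. f $ x * f $ y)"
    by (simp add: power2_diff algebra_simps sum.distrib sum_subtractf sum_distrib_left)
  moreover have "dirichlet_form Q \<mu> f =
      (\<Sum>x\<in>UNIV. (f $ x)\<^sup>2 * \<mu> $ x) - ?S (\<lambda>x y. f $ x * f $ y)"
    by (simp add: dirichlet_form_def l2_inner_def matrix_vector_mult_def algebra_simps
        power2_eq_square sum_subtractf sum_distrib_left)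
  ultimately show ?thesis
    using a b by simp
qed

definition nash_inequality ::
    "real \<Rightarrow> real \<Rightarrow> real \<Rightarrow> real ^ 'v ^ 'v \<Rightarrow> real ^ 'v \<Rightarrow> bool" where
  "nash_inequality C D T Q \<mu> \<longleftrightarrow>
     (\<forall>f. lp_norm 2 \<mu> f powr (2 + 1 / D)
        \<le> C * (dirichlet_form Q \<mu> f + 1 / T * (lp_norm 2 \<mu> f)\<^sup>2) * lp_norm 1 \<mu> f powr (1 / D))"

text \<open>Index \<open>0\<close> carries no condition.  Finiteness of \<open>mass (\<pi> t)\<close> is automatic since \<open>'v\<close> is finite.\<close>

definition nondecreasing_environment ::
    "(nat \<Rightarrow> real ^ 'v ^ 'v) \<Rightarrow> (nat \<Rightarrow> real ^ 'v) \<Rightarrow> bool" where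
  "nondecreasing_environment K \<pi> \<longleftrightarrow>
     (\<forall>t\<ge>1. (\<forall>x. \<pi> t $ x > 0) \<and> \<pi> t v* K t = \<pi> t \<and> (\<forall>x. \<pi> (t + 1) $ x \<ge> \<pi> t $ x))"

definition centered :: "real ^ 'v \<Rightarrow> real ^ 'v ^ 'v \<Rightarrow> real ^ 'v \<Rightarrow> real ^ 'v" where
  "centered \<mu> A f = A *v f - vec (expect \<mu> (A *v f))"

end

theory Submission
  imports Defs
begin

text \<open>
  In the unnormalised norms of the \<open>\<pi> s\<close>, the map \<open>K s\<close> contracts \<open>\<ell>\<^sup>1\<close> and \<open>\<ell>\<^sup>2\<close>, and passing from
  \<open>\<pi> s\<close> to the smaller \<open>\<pi> (s - 1)\<close> decreases both norms.  As \<open>mass (\<pi> s) \<ge> 1\<close>, the Nash inequality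
  survives without the normalisation, and it turns the decrement of the squared \<open>\<ell>\<^sup>2\<close> norm of
  \<open>K_between K s t *v f\<close> as \<open>s\<close> goes down into polynomial decay, which is the \<open>\<ell>\<^sup>1 \<rightarrow> \<ell>\<^sup>2\<close> bound.
  Jensen's inequality \<open>(K f)\<^sup>2 \<le> K (f\<^sup>2)\<close> and repeated halving of the time interval upgrade it to the
  \<open>\<ell>\<^sup>2 \<rightarrow> \<ell>\<^sup>\<infinity>\<close> bound; no estimate for the adjoint kernels is needed.
\<close>

lemma lp_norm_1:
  assumes "\<And>x. 0 \<le> \<mu> $ x"
  shows "lp_norm 1 \<mu> f = (\<Sum>x\<in>UNIV. \<bar>f $ x\<bar> * \<mu> $ x)"
  by (simp add: lp_norm_def sum_nonneg assms)

lemma l2_inner_nonneg: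
  assumes "\<And>x. 0 \<le> \<mu> $ x"
  shows "0 \<le> l2_inner \<mu> f f"
  by (simp add: l2_inner_def sum_nonneg assms)

lemma lp_norm_2:
  assumes "\<And>x. 0 \<le> \<mu> $ x"
  shows "lp_norm 2 \<mu> f = sqrt (l2_inner \<mu> f f)"
proof -
  have "\<bar>a\<bar> powr 2 = a * a" for a :: real
    by (cases "a = 0") (simp_all add: powr_numeral power2_eq_square flip: abs_mult)
  then show ?thesis
    using l2_inner_nonneg[OF assms] by (simp add: lp_norm_def l2_inner_def powr_half_sqrt)
qed

lemma lp_norm_nonneg: "0 \<le> lp_norm p \<mu> f"
  by (simp add: lp_norm_def)

lemma lp_norm_normalized:
  assumes "\<And>x. 0 \<le> \<mu> $ x"
  shows "lp_norm p (normalized \<mu>) f = lp_norm p \<mu> f / mass \<mu> powr (1 / p)"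
proof -
  have "(\<Sum>x\<in>UNIV. \<bar>f $ x\<bar> powr p * normalized \<mu> $ x) = (\<Sum>x\<in>UNIV. \<bar>f $ x\<bar> powr p * \<mu> $ x) / mass \<mu>"
    by (simp add: normalized_def sum_divide_distrib)
  then show ?thesis
    by (simp add: lp_norm_def powr_divide sum_nonneg assms mass_def)
qed

lemma markov_nonneg: "markov_operator K \<Longrightarrow> 0 \<le> K $ x $ y"
  and markov_row: "markov_operator K \<Longrightarrow> (\<Sum>y\<in>UNIV. K $ x $ y) = 1"
  by (auto simp: markov_operator_def)

lemma markov_operatorI:
  fixes K :: "real ^ 'v ^ 'v"
  assumes nonneg: "\<And>x y. 0 \<le> K $ x $ y" and row: "\<And>x. (\<Sum>y\<in>UNIV. K $ x $ y) = 1"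
  shows "markov_operator K"
proof -
  have "K $ x $ y \<le> 1" for x y
    using member_le_sum[of y UNIV "\<lambda>y. K $ x $ y"] nonneg row[of x] by simp
  then show ?thesis
    using assms by (simp add: markov_operator_def)
qed

lemma markov_one: "markov_operator (mat 1 :: real ^ 'v ^ 'v)"
  by (rule markov_operatorI) (auto simp: mat_def)

lemma markov_mult:
  fixes A B :: "real ^ 'v ^ 'v"
  assumes A: "markov_operator A" and B: "markov_operator B"
  shows "markov_operator (A ** B)"
proof (rule markov_operatorI)
  show "0 \<le> (A ** B) $ x $ y" for x y
    by (simp add: matrix_matrix_mult_def sum_nonneg markov_nonneg[OF A] markov_nonneg[OF B])
  show "(\<Sum>y\<in>UNIV. (A ** B) $ x $ y) = 1" for x
  proof -
    have "(\<Sum>y\<in>UNIV. (A ** B) $ x $ y) = (\<Sum>z\<in>UNIV. A $ x $ z * (\<Sum>y\<in>UNIV. B $ z $ y))"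
      unfolding matrix_matrix_mult_def sum_distrib_left by (simp, rule sum.swap)
    then show ?thesis
      by (simp add: markov_row[OF A] markov_row[OF B])
  qed
qed

lemma markov_abs_le:
  assumes "markov_operator K"
  shows "\<bar>(K *v f) $ x\<bar> \<le> (K *v (\<chi> y. \<bar>f $ y\<bar>)) $ x"
  using sum_abs[of "\<lambda>y. K $ x $ y * f $ y" UNIV]
  by (simp add: matrix_vector_mult_def abs_mult markov_nonneg[OF assms])

text \<open>The nonnegative quantity expanded below is the variance of \<open>f\<close> under \<open>K x\<close>.\<close>

lemma markov_square_le:
  assumes "markov_operator K"
  shows "((K *v f) $ x)\<^sup>2 \<le> (K *v (\<chi> y. (f $ y)\<^sup>2)) $ x"
proof -
  define m where "m = (\<Sum>y\<in>UNIV. K $ x $ y * f $ y)"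
  have "0 \<le> (\<Sum>y\<in>UNIV. K $ x $ y * (f $ y - m)\<^sup>2)"
    by (simp add: sum_nonneg markov_nonneg[OF assms])
  also have "\<dots> = (\<Sum>y\<in>UNIV. K $ x $ y * (f $ y)\<^sup>2) - 2 * m * (\<Sum>y\<in>UNIV. K $ x $ y * f $ y)
      + m\<^sup>2 * (\<Sum>y\<in>UNIV. K $ x $ y)"
    by (simp add: power2_diff algebra_simps sum.distrib sum_subtractf sum_distrib_left)
  also have "\<dots> = (\<Sum>y\<in>UNIV. K $ x $ y * (f $ y)\<^sup>2) - m\<^sup>2"
    by (simp add: markov_row[OF assms] power2_eq_square flip: m_def)
  finally show ?thesis
    by (simp add: matrix_vector_mult_def m_def)
qed

lemma expect_invariant:
  assumes "\<mu> v* K = \<mu>"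
  shows "expect \<mu> (K *v f) = expect \<mu> f"
proof -
  have "expect \<mu> (K *v f) = (\<Sum>y\<in>UNIV. f $ y * (\<mu> v* K) $ y)"
    unfolding expect_def matrix_vector_mult_def vector_matrix_mult_def sum_distrib_right
    by (simp add: sum_distrib_left mult_ac, rule sum.swap)
  then show ?thesis
    by (simp add: assms expect_def)
qed

lemma l2_contraction:
  assumes "markov_operator K" "\<mu> v* K = \<mu>" "\<And>x. 0 \<le> \<mu> $ x"
  shows "l2_inner \<mu> (K *v f) (K *v f) \<le> l2_inner \<mu> f f"
proof -
  have "l2_inner \<mu> (K *v f) (K *v f) \<le> expect \<mu> (K *v (\<chi> y. (f $ y)\<^sup>2))"
    unfolding l2_inner_def expect_def power2_eq_square[symmetric]
    by (intro sum_mono mult_right_mono markov_square_le assms)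
  then show ?thesis
    by (simp add: expect_invariant assms) (simp add: expect_def l2_inner_def power2_eq_square)
qed

lemma l1_contraction:
  assumes "markov_operator K" "\<mu> v* K = \<mu>" "\<And>x. 0 \<le> \<mu> $ x"
  shows "lp_norm 1 \<mu> (K *v f) \<le> lp_norm 1 \<mu> f"
proof -
  have "(\<Sum>x\<in>UNIV. \<bar>(K *v f) $ x\<bar> * \<mu> $ x) \<le> expect \<mu> (K *v (\<chi> y. \<bar>f $ y\<bar>))"
    unfolding expect_def by (intro sum_mono mult_right_mono markov_abs_le assms)
  then show ?thesis
    by (simp add: expect_invariant assms lp_norm_1) (simp add: expect_def)
qed

lemma l2_inner_measure_mono:
  assumes "\<And>x. \<mu> $ x \<le> \<nu> $ x"
  shows "l2_inner \<mu> f f \<le> l2_inner \<nu> f f"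
  unfolding l2_inner_def by (intro sum_mono mult_left_mono assms) simp

lemma l1_measure_mono:
  assumes "\<And>x. 0 \<le> \<mu> $ x" "\<And>x. \<mu> $ x \<le> \<nu> $ x"
  shows "lp_norm 1 \<mu> f \<le> lp_norm 1 \<nu> f"
proof -
  have "0 \<le> \<nu> $ x" for x
    using assms[of x] by linarith
  then show ?thesis
    using assms by (simp add: lp_norm_1 sum_mono mult_left_mono)
qed

lemma dirichlet_form_adjoint:
  fixes K :: "real ^ 'v ^ 'v"
  assumes "\<And>x. 0 < \<mu> $ x"
  shows "dirichlet_form (l2_adjoint \<mu> K ** K) \<mu> f = l2_inner \<mu> f f - l2_inner \<mu> (K *v f) (K *v f)"
proof -
  have "l2_inner \<mu> (l2_adjoint \<mu> K *v g) f = l2_inner \<mu> g (K *v f)" for g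
  proof -
    have "l2_inner \<mu> (l2_adjoint \<mu> K *v g) f = (\<Sum>x\<in>UNIV. \<Sum>y\<in>UNIV. \<mu> $ y * K $ y $ x * g $ y * f $ x)"
      using less_imp_neq[OF assms, symmetric]
      by (simp add: l2_adjoint_eq[OF assms] l2_inner_def matrix_vector_mult_def sum_distrib_right)
    also have "\<dots> = (\<Sum>y\<in>UNIV. \<Sum>x\<in>UNIV. \<mu> $ y * K $ y $ x * g $ y * f $ x)"
      by (rule sum.swap)
    also have "\<dots> = l2_inner \<mu> g (K *v f)"
      by (simp add: l2_inner_def matrix_vector_mult_def sum_distrib_left sum_distrib_right mult_ac)
    finally show ?thesis .
  qed
  then show ?thesis
    by (simp add: dirichlet_form_def matrix_vector_mul_assoc[symmetric])
       (simp add: l2_inner_def left_diff_distrib sum_subtractf)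
qed

lemma nash_unnormalized:
  fixes K :: "real ^ 'v ^ 'v"
  assumes pos: "\<And>x. 0 < \<mu> $ x" and mass: "1 \<le> mass \<mu>"
    and K: "markov_operator K" "\<mu> v* K = \<mu>"
    and "0 < C" "0 < D" "1 \<le> T"
    and nash: "nash_inequality C D T (l2_adjoint (normalized \<mu>) K ** K) (normalized \<mu>)"
  shows "l2_inner \<mu> f f powr (1 + 1 / (2 * D)) \<le>
    C * (l2_inner \<mu> f f - l2_inner \<mu> (K *v f) (K *v f) + l2_inner \<mu> f f / T) * lp_norm 1 \<mu> f powr (1 / D)"
proof -
  define m where "m = mass \<mu>"
  define U where "U = l2_inner \<mu> f f"
  define E where "E = U - l2_inner \<mu> (K *v f) (K *v f)"
  define L where "L = lp_norm 1 \<mu> f"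
  have m: "1 \<le> m" using mass by (simp add: m_def)
  have nn: "\<And>x. 0 \<le> \<mu> $ x" using pos less_imp_le by blast
  have U: "0 \<le> U" by (simp add: U_def l2_inner_nonneg nn)
  have E: "0 \<le> E" using l2_contraction[OF K nn] by (simp add: E_def U_def)
  have L: "0 \<le> L" by (simp add: L_def lp_norm_nonneg)
  have npos: "0 < normalized \<mu> $ x" for x
    using pos m by (simp add: normalized_def flip: m_def)
  have inner: "l2_inner (normalized \<mu>) g h = l2_inner \<mu> g h / m" for g h
    by (simp add: l2_inner_def normalized_def sum_divide_distrib m_def)
  have two: "lp_norm 2 (normalized \<mu>) f = sqrt (U / m)"
    using m by (simp add: lp_norm_2 npos less_imp_le inner U_def)
  have one: "lp_norm 1 (normalized \<mu>) f = L / m"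
    using m nn by (simp add: lp_norm_normalized L_def m_def)
  have df: "dirichlet_form (l2_adjoint (normalized \<mu>) K ** K) (normalized \<mu>) f = E / m"
    by (simp add: dirichlet_form_adjoint npos inner E_def U_def diff_divide_distrib)
  have "sqrt (U / m) powr (2 + 1 / D) = (U / m) powr (1 + 1 / (2 * D))"
    using U m by (simp add: powr_powr algebra_simps flip: powr_half_sqrt)
  moreover have "(sqrt (U / m))\<^sup>2 = U / m" using U m by simp
  ultimately have "(U / m) powr (1 + 1 / (2 * D)) \<le> C * (E / m + 1 / T * (U / m)) * (L / m) powr (1 / D)"
    using nash[unfolded nash_inequality_def, rule_format, of f] unfolding two one df by simp
  also have "\<dots> = C * (E + U / T) * L powr (1 / D) / (m * m powr (1 / D))"
    using m L by (simp add: powr_divide field_simps)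
  finally have "U powr (1 + 1 / (2 * D)) \<le> C * (E + U / T) * L powr (1 / D) * (m powr (1 + 1 / (2 * D)) / (m * m powr (1 / D)))"
    using m U by (simp add: powr_divide field_simps)
  also have "\<dots> \<le> C * (E + U / T) * L powr (1 / D) * 1"
  proof (rule mult_left_mono)
    have "m powr (1 + 1 / (2 * D)) \<le> m powr (1 + 1 / D)"
      using m \<open>0 < D\<close> by (intro powr_mono) (auto simp: field_simps)
    also have "\<dots> = m * m powr (1 / D)" using m by (simp add: powr_add)
    finally show "m powr (1 + 1 / (2 * D)) / (m * m powr (1 / D)) \<le> 1" using m by simp
    show "0 \<le> C * (E + U / T) * L powr (1 / D)" using E U assms by simp
  qed
  finally show ?thesis by (simp add: U_def E_def L_def)
qed

text \<open>In the induction step either \<open>u n\<close> already meets the bound for \<open>Suc n\<close>, or it is so large that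
  the Nash inequality forces the factor \<open>(1 - 1 / (n + 2)) powr (2 * D)\<close>.\<close>

lemma nash_sequence_decay:
  fixes u :: "nat \<Rightarrow> real" and A D T :: real
  assumes "0 < A" "0 < D" "1 \<le> T" and nonneg: "\<And>n. 0 \<le> u n"
    and base: "u 0 powr (1 + 1 / (2 * D)) \<le> A * (u 0 + u 0 / T)"
    and decr: "\<And>n. n < N \<Longrightarrow> u (Suc n) \<le> u n"
    and step: "\<And>n. n < N \<Longrightarrow> u n powr (1 + 1 / (2 * D)) \<le> A * (u n - u (Suc n) + u n / T)"
    and "real N \<le> T"
  shows "n \<le> N \<Longrightarrow> u n \<le> (A * ((1 + 1 / T) * (1 + real_of_int \<lceil>4 * D\<rceil>)) / (real n + 1)) powr (2 * D)"
proof -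
  define k where "k = nat \<lceil>4 * D\<rceil>"
  define B where "B = (1 + 1 / T) * (1 + real k)"
  have k: "real k = real_of_int \<lceil>4 * D\<rceil>"
    using \<open>0 < D\<close> by (simp add: k_def)
  have "2 * D \<le> real k"
    unfolding k using le_of_int_ceiling[of "4 * D"] \<open>0 < D\<close> by linarith
  have Bge: "1 + 1 / T + real k \<le> B"
    using \<open>1 \<le> T\<close> by (simp add: B_def algebra_simps)
  have "0 < 1 / T" using \<open>1 \<le> T\<close> by simp
  then have Bpos: "0 < B" using Bge by linarith
  have root: "v \<le> w powr (2 * D)" if "v powr (1 / (2 * D)) \<le> w" "0 \<le> v" for v w :: real
    using powr_mono2[of "2 * D" "v powr (1 / (2 * D))" w] that \<open>0 < D\<close> by (simp add: powr_powr)
  have "n \<le> N \<Longrightarrow> u n \<le> (A * B / (real n + 1)) powr (2 * D)"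
  proof (induction n)
    case 0
    have "u 0 powr (1 / (2 * D)) \<le> A * B"
    proof (cases "u 0 = 0")
      case False
      then have "0 < u 0" using nonneg[of 0] by linarith
      then have "u 0 * u 0 powr (1 / (2 * D)) \<le> u 0 * (A * (1 + 1 / T))"
        using base by (simp add: powr_add algebra_simps)
      then have "u 0 powr (1 / (2 * D)) \<le> A * (1 + 1 / T)"
        using \<open>0 < u 0\<close> by simp
      also have "\<dots> \<le> A * B"
        using Bge \<open>0 < A\<close> by (intro mult_left_mono) auto
      finally show ?thesis .
    qed (use \<open>0 < A\<close> Bpos in simp)
    then show ?case using root nonneg by simp
  next
    case (Suc n)
    then have n: "n < N" and IH: "u n \<le> (A * B / (real n + 1)) powr (2 * D)"
      by simp_all
    have "u (Suc n) \<le> (A * B / (real n + 2)) powr (2 * D)"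
    proof (cases "u n powr (1 / (2 * D)) \<le> A * B / (real n + 2)")
      case True
      then show ?thesis using root[OF True nonneg] decr[OF n] by linarith
    next
      case False
      have "0 < A * B / (real n + 2)" using \<open>0 < A\<close> Bpos by simp
      with False have "u n \<noteq> 0" by (intro notI) simp
      then have un: "0 < u n" using nonneg[of n] by linarith
      have "u n * (A * B / (real n + 2)) \<le> u n * u n powr (1 / (2 * D))"
        using False un by (intro mult_left_mono) auto
      also have "\<dots> \<le> A * (u n - u (Suc n) + u n / T)"
        using step[OF n] un by (simp add: powr_add)
      finally have "A * (u n * (B / (real n + 2))) \<le> A * (u n - u (Suc n) + u n / T)"
        by (simp add: mult_ac)
      then have "u n * (B / (real n + 2)) \<le> u n - u (Suc n) + u n / T"
        using \<open>0 < A\<close> by (simp only: mult_le_cancel_left_pos)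
      then have le: "u (Suc n) \<le> u n * (1 + 1 / T - B / (real n + 2))"
        by (simp add: algebra_simps)
      have "real n + 2 \<le> T + 1" using n \<open>real N \<le> T\<close> by linarith
      then have "(real n + 2) / T \<le> (T + 1) / T"
        using \<open>1 \<le> T\<close> by (intro divide_right_mono) auto
      then have "(real n + 2) / T \<le> 1 + 1 / T"
        using \<open>1 \<le> T\<close> by (simp add: add_divide_distrib)
      then have "(real n + 2) / T + real k \<le> B"
        using Bge by linarith
      then have "((real n + 2) / T + real k) / (real n + 2) \<le> B / (real n + 2)"
        by (intro divide_right_mono) auto
      moreover have "((real n + 2) / T + real k) / (real n + 2) = 1 / T + real k / (real n + 2)"
        by (subst add_divide_distrib) simp
      ultimately have "1 + 1 / T - B / (real n + 2) \<le> 1 + real k * (- 1 / (real n + 2))"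
        by simp
      also have "\<dots> \<le> (1 + - 1 / (real n + 2)) ^ k"
        by (intro Bernoulli_inequality) simp
      also have "1 + - 1 / (real n + 2) = (real n + 1) / (real n + 2)"
        by (simp add: field_simps)
      also have "((real n + 1) / (real n + 2)) ^ k = ((real n + 1) / (real n + 2)) powr real k"
        by (simp add: powr_realpow)
      also have "\<dots> \<le> ((real n + 1) / (real n + 2)) powr (2 * D)"
        using \<open>2 * D \<le> real k\<close> by (intro powr_mono') auto
      finally have "u (Suc n) \<le> u n * ((real n + 1) / (real n + 2)) powr (2 * D)"
        using le un by (meson mult_left_mono order_trans less_imp_le)
      also have "\<dots> \<le> (A * B / (real n + 1)) powr (2 * D) * ((real n + 1) / (real n + 2)) powr (2 * D)"
        by (intro mult_right_mono IH) simp
      also have "\<dots> = (A * B / (real n + 2)) powr (2 * D)"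
        using \<open>0 < A\<close> Bpos by (simp flip: powr_mult)
      finally show ?thesis .
    qed
    then show ?case by (simp add: add_ac)
  qed
  then show "n \<le> N \<Longrightarrow> ?thesis" by (simp add: B_def k)
qed

lemma K_between_refl: "K_between K t t = mat 1"
  by (simp add: K_between_def)

lemma K_between_Suc:
  assumes "s < t"
  shows "K_between K s t = K (Suc s) ** K_between K (Suc s) t"
proof -
  have "[Suc s..<Suc t] = Suc s # [Suc (Suc s)..<Suc t]"
    using assms by (intro upt_conv_Cons) simp
  then show ?thesis unfolding K_between_def by (simp del: upt_Suc)
qed

lemma K_between_split:
  fixes K :: "nat \<Rightarrow> real ^ 'v ^ 'v"
  assumes "r \<le> s" "s \<le> t"
  shows "K_between K r t = K_between K r s ** K_between K s t"
  using assms
proof (induction r rule: inc_induct)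
  case base
  show ?case by (simp add: K_between_refl)
next
  case (step n)
  then show ?case using K_between_Suc[of n t K] K_between_Suc[of n s K]
    by (simp add: matrix_mul_assoc)
qed

lemma markov_K_between:
  fixes K :: "nat \<Rightarrow> real ^ 'v ^ 'v"
  assumes "\<And>s. 1 \<le> s \<Longrightarrow> markov_operator (K s)" "r \<le> t"
  shows "markov_operator (K_between K r t)"
  using assms(2)
proof (induction r rule: inc_induct)
  case base
  show ?case by (simp add: K_between_refl markov_one)
next
  case (step n)
  then show ?case by (simp add: K_between_Suc markov_mult assms(1))
qed

locale nash_environment =
  fixes K :: "nat \<Rightarrow> real ^ 'v ^ 'v" and \<pi> :: "nat \<Rightarrow> real ^ 'v" and C D T :: real
  assumes markov: "\<And>s. s \<ge> 1 \<Longrightarrow> markov_operator (K s)"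
    and environment: "nondecreasing_environment K \<pi>"
    and pi_0: "\<pi> 0 = \<pi> 1"
    and T: "T \<ge> 1" and C: "C > 0" and D: "D > 0"
    and nash: "\<And>s. s \<ge> 1 \<Longrightarrow>
      nash_inequality C D T (l2_adjoint (normalized (\<pi> s)) (K s) ** K s) (normalized (\<pi> s))"
    and mass_1: "mass (\<pi> 1) \<ge> 1"
begin

lemma pi_pos: "0 < \<pi> s $ x"
  using environment pi_0 by (cases "s = 0") (auto simp: nondecreasing_environment_def)

lemma pi_nonneg: "0 \<le> \<pi> s $ x"
  using pi_pos less_imp_le by blast

lemma pi_Suc_mono: "\<pi> s $ x \<le> \<pi> (Suc s) $ x"
  using environment pi_0 by (cases "s = 0") (auto simp: nondecreasing_environment_def)

lemma pi_invariant: "1 \<le> s \<Longrightarrow> \<pi> s v* K s = \<pi> s"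
  using environment by (auto simp: nondecreasing_environment_def)

lemma mass_ge_1: "1 \<le> mass (\<pi> s)"
proof (induction s)
  case (Suc s)
  have "mass (\<pi> s) \<le> mass (\<pi> (Suc s))"
    unfolding mass_def by (intro sum_mono pi_Suc_mono)
  with Suc show ?case by simp
qed (simp add: pi_0 mass_1[simplified])

lemma l2_step: "l2_inner (\<pi> s) (K (Suc s) *v f) (K (Suc s) *v f)
    \<le> l2_inner (\<pi> (Suc s)) (K (Suc s) *v f) (K (Suc s) *v f)"
  by (intro l2_inner_measure_mono pi_Suc_mono)

lemma l1_step: "lp_norm 1 (\<pi> s) (K (Suc s) *v f) \<le> lp_norm 1 (\<pi> (Suc s)) f"
proof -
  have "lp_norm 1 (\<pi> s) (K (Suc s) *v f) \<le> lp_norm 1 (\<pi> (Suc s)) (K (Suc s) *v f)"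
    by (intro l1_measure_mono pi_nonneg pi_Suc_mono)
  also have "\<dots> \<le> lp_norm 1 (\<pi> (Suc s)) f"
    by (intro l1_contraction markov pi_invariant pi_nonneg) auto
  finally show ?thesis .
qed

lemma l1_K_between:
  assumes "s \<le> t"
  shows "lp_norm 1 (\<pi> s) (K_between K s t *v f) \<le> lp_norm 1 (\<pi> t) f"
  using assms
proof (induction s rule: inc_induct)
  case (step n)
  then show ?case using l1_step[of n "K_between K (Suc n) t *v f"]
    by (simp add: K_between_Suc matrix_vector_mul_assoc)
qed (simp add: K_between_refl)

lemma nash_pi:
  assumes "1 \<le> s"
  shows "l2_inner (\<pi> s) f f powr (1 + 1 / (2 * D)) \<le>
    C * (l2_inner (\<pi> s) f f - l2_inner (\<pi> s) (K s *v f) (K s *v f) + l2_inner (\<pi> s) f f / T)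
      * lp_norm 1 (\<pi> s) f powr (1 / D)"
  using assms by (intro nash_unnormalized pi_pos mass_ge_1 markov pi_invariant nash C D T)

text \<open>At \<open>s = 0\<close> there is no kernel; the inequality comes from \<open>K 1\<close> because \<open>\<pi> 0 = \<pi> 1\<close>.\<close>

lemma nash_pi_weak:
  "l2_inner (\<pi> s) f f powr (1 + 1 / (2 * D)) \<le>
    C * (l2_inner (\<pi> s) f f + l2_inner (\<pi> s) f f / T) * lp_norm 1 (\<pi> s) f powr (1 / D)"
proof -
  define s' where "s' = max 1 s"
  have "\<pi> s = \<pi> s'"
    using pi_0 by (cases "s = 0") (auto simp: s'_def max_def)
  have "l2_inner (\<pi> s') f f powr (1 + 1 / (2 * D)) \<le>
      C * (l2_inner (\<pi> s') f f - l2_inner (\<pi> s') (K s' *v f) (K s' *v f) + l2_inner (\<pi> s') f f / T)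
        * lp_norm 1 (\<pi> s') f powr (1 / D)"
    by (rule nash_pi) (simp add: s'_def)
  also have "\<dots> \<le> C * (l2_inner (\<pi> s') f f + l2_inner (\<pi> s') f f / T) * lp_norm 1 (\<pi> s') f powr (1 / D)"
    using l2_inner_nonneg[OF pi_nonneg, of s' "K s' *v f"] C by (intro mult_right_mono mult_left_mono) auto
  finally show ?thesis by (simp only: \<open>\<pi> s = \<pi> s'\<close>)
qed

definition l1_l2_const :: "nat \<Rightarrow> real" where
  "l1_l2_const n = (C * ((1 + 1 / T) * (1 + real_of_int \<lceil>4 * D\<rceil>)) / (real n + 1)) powr D"

lemma decay_base_pos: "0 < C * ((1 + 1 / T) * (1 + real_of_int \<lceil>4 * D\<rceil>))"
proof -
  have "0 < 1 + 1 / T" using T by (simp add: add_pos_pos)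
  moreover have "0 < 1 + real_of_int \<lceil>4 * D\<rceil>"
    using le_of_int_ceiling[of "4 * D"] D by linarith
  ultimately show ?thesis using C by simp
qed

lemma l1_l2_bound:
  assumes "r \<le> t" "real t \<le> T"
  shows "lp_norm 2 (\<pi> r) (K_between K r t *v f) \<le> l1_l2_const (t - r) * lp_norm 1 (\<pi> t) f"
proof (cases "lp_norm 1 (\<pi> t) f = 0")
  case True
  then have "f = 0"
    using pi_pos[of t] by (auto simp: lp_norm_1 pi_nonneg sum_nonneg_eq_0_iff vec_eq_iff less_le)
  then show ?thesis by (simp add: lp_norm_def lp_norm_1 pi_nonneg)
next
  case False
  define M where "M = lp_norm 1 (\<pi> t) f"
  have M: "0 < M" using False lp_norm_nonneg[of 1 "\<pi> t" f] by (simp add: M_def)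
  define g where "g n = K_between K (t - n) t *v f" for n
  define u where "u n = l2_inner (\<pi> (t - n)) (g n) (g n)" for n
  have g0: "g 0 = f" by (simp add: g_def K_between_refl)
  have gM: "lp_norm 1 (\<pi> (t - n)) (g n) powr (1 / D) \<le> M powr (1 / D)" for n
    unfolding g_def M_def using D by (intro powr_mono2 l1_K_between lp_norm_nonneg) auto
  have u: "0 \<le> u n" for n
    unfolding u_def by (intro l2_inner_nonneg pi_nonneg)
  have gS: "g (Suc n) = K (t - n) *v g n" and tS: "Suc (t - Suc n) = t - n" if "n < t - r" for n
  proof -
    show tS: "Suc (t - Suc n) = t - n" using that by simp
    show "g (Suc n) = K (t - n) *v g n"
      using that K_between_Suc[of "t - Suc n" t K] tS by (simp add: g_def matrix_vector_mul_assoc)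
  qed
  have uS: "u (Suc n) \<le> l2_inner (\<pi> (t - n)) (K (t - n) *v g n) (K (t - n) *v g n)" if "n < t - r" for n
    using l2_step[of "t - Suc n" "g n"] by (simp add: u_def gS[OF that] tS[OF that])
  have decr: "u (Suc n) \<le> u n" if "n < t - r" for n
  proof -
    have "1 \<le> t - n" using that by simp
    then have "l2_inner (\<pi> (t - n)) (K (t - n) *v g n) (K (t - n) *v g n) \<le> u n"
      unfolding u_def by (intro l2_contraction markov pi_invariant pi_nonneg)
    then show ?thesis using uS[OF that] by linarith
  qed
  have base: "u 0 powr (1 + 1 / (2 * D)) \<le> C * M powr (1 / D) * (u 0 + u 0 / T)"
    using nash_pi_weak[of t f] by (simp add: u_def g0 M_def mult_ac)
  have step: "u n powr (1 + 1 / (2 * D)) \<le> C * M powr (1 / D) * (u n - u (Suc n) + u n / T)"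
    if "n < t - r" for n
  proof -
    have "u n powr (1 + 1 / (2 * D)) \<le> C * (u n - l2_inner (\<pi> (t - n)) (K (t - n) *v g n) (K (t - n) *v g n)
        + u n / T) * lp_norm 1 (\<pi> (t - n)) (g n) powr (1 / D)"
      using nash_pi[of "t - n" "g n"] that by (simp add: u_def)
    also have "\<dots> \<le> C * (u n - u (Suc n) + u n / T) * M powr (1 / D)"
      using C T u[of n] decr[OF that] uS[OF that] gM[of n]
      by (intro mult_mono mult_left_mono) auto
    finally show ?thesis by (simp add: mult_ac)
  qed
  let ?B = "C * ((1 + 1 / T) * (1 + real_of_int \<lceil>4 * D\<rceil>))"
  have "u (t - r) \<le> (C * M powr (1 / D) * ((1 + 1 / T) * (1 + real_of_int \<lceil>4 * D\<rceil>))
      / (real (t - r) + 1)) powr (2 * D)"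
    using C D T M assms u base decr step by (intro nash_sequence_decay[where N = "t - r"]) auto
  also have "\<dots> = (?B / (real (t - r) + 1) * M powr (1 / D)) powr (2 * D)"
    by (simp add: mult_ac)
  also have "\<dots> = (?B / (real (t - r) + 1)) powr (2 * D) * (M powr (1 / D)) powr (2 * D)"
    using decay_base_pos by (intro powr_mult)
  also have "\<dots> = (l1_l2_const (t - r) * M)\<^sup>2"
    using D M by (simp add: l1_l2_const_def powr_powr power_mult_distrib power2_eq_square flip: powr_add)
  finally have "sqrt (u (t - r)) \<le> l1_l2_const (t - r) * M"
    using M by (intro real_le_lsqrt) (auto simp: l1_l2_const_def)
  then show ?thesis
    using assms by (simp add: u_def g_def lp_norm_2 pi_nonneg M_def)
qed

lemma l1_l2_const_nonneg: "0 \<le> l1_l2_const n"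
  by (simp add: l1_l2_const_def)

lemma l1_l2_const_half:
  assumes "n \<le> 2 * p + 1"
  shows "l1_l2_const p \<le> 2 powr D * l1_l2_const n"
proof -
  define B where "B = C * ((1 + 1 / T) * (1 + real_of_int \<lceil>4 * D\<rceil>))"
  have B: "0 < B" unfolding B_def by (rule decay_base_pos)
  have "real n + 1 \<le> 2 * (real p + 1)" using of_nat_mono[OF assms, where 'a = real] by simp
  then have "B / (real p + 1) \<le> 2 * (B / (real n + 1))"
    using B by (simp add: divide_simps mult_ac)
  then have "(B / (real p + 1)) powr D \<le> (2 * (B / (real n + 1))) powr D"
    using B D by (intro powr_mono2) auto
  then show ?thesis
    using B by (simp only: powr_mult l1_l2_const_def B_def)
qed

text \<open>Extrapolation from \<open>\<ell>\<^sup>1 \<rightarrow> \<ell>\<^sup>2\<close> to \<open>\<ell>\<^sup>2 \<rightarrow> \<ell>\<^sup>\<infinity>\<close>: with \<open>\<bar>K f\<bar>\<^sup>2 \<le> K (f\<^sup>2)\<close>, the square of the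
  bound for an interval is the \<open>\<ell>\<^sup>2 \<rightarrow> \<ell>\<^sup>\<infinity>\<close> bound for its first half times the \<open>\<ell>\<^sup>1 \<rightarrow> \<ell>\<^sup>2\<close> bound
  for its second half, and \<open>4 powr D\<close> is the factor that this recursion reproduces.\<close>

lemma l2_linf_bound:
  assumes "r \<le> t" "real t \<le> T"
  shows "\<bar>(K_between K r t *v f) $ x\<bar> \<le> 4 powr D * l1_l2_const (t - r) * lp_norm 2 (\<pi> t) f"
  using assms
proof (induction "t - r" arbitrary: r t f x rule: less_induct)
  case less
  show ?case
  proof (cases "r = t")
    case True
    define p where "p = \<pi> t $ x"
    have p: "0 < p" by (simp add: p_def pi_pos)
    have "lp_norm 2 (\<pi> t) (axis x 1) = sqrt p" "lp_norm 1 (\<pi> t) (axis x 1) = p"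
      by (simp_all add: lp_norm_2 lp_norm_1 pi_nonneg l2_inner_def axis_def p_def if_distrib if_distribR
          cong: if_cong)
    then have "sqrt p \<le> l1_l2_const 0 * p"
      using l1_l2_bound[of t t "axis x 1"] less.prems by (simp add: K_between_refl)
    also have "l1_l2_const 0 * p = sqrt p * (l1_l2_const 0 * sqrt p)"
      using p by simp
    finally have "sqrt p * 1 \<le> sqrt p * (l1_l2_const 0 * sqrt p)" by (simp only: mult_1_right)
    then have "1 \<le> l1_l2_const 0 * sqrt p"
      using p by (simp only: mult_le_cancel_left_pos real_sqrt_gt_zero)
    then have "\<bar>f $ x\<bar> * 1 \<le> \<bar>f $ x\<bar> * (l1_l2_const 0 * sqrt p)"
      by (intro mult_left_mono) auto
    also have "\<dots> = l1_l2_const 0 * sqrt (f $ x * f $ x * p)"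
      by (simp add: real_sqrt_mult)
    also have "\<dots> \<le> l1_l2_const 0 * lp_norm 2 (\<pi> t) f"
    proof -
      have "f $ x * f $ x * \<pi> t $ x \<le> l2_inner (\<pi> t) f f"
        unfolding l2_inner_def by (intro member_le_sum) (auto simp: pi_nonneg)
      then show ?thesis
        by (intro mult_left_mono) (auto simp: lp_norm_2 pi_nonneg p_def l1_l2_const_nonneg)
    qed
    also have "\<dots> \<le> 4 powr D * (l1_l2_const 0 * lp_norm 2 (\<pi> t) f)"
    proof -
      have "1 \<le> 4 powr D" using D by (intro ge_one_powr_ge_zero) auto
      then have "1 * (l1_l2_const 0 * lp_norm 2 (\<pi> t) f) \<le> 4 powr D * (l1_l2_const 0 * lp_norm 2 (\<pi> t) f)"
        by (intro mult_right_mono mult_nonneg_nonneg l1_l2_const_nonneg lp_norm_nonneg)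
      then show ?thesis by simp
    qed
    finally show ?thesis using True by (simp add: K_between_refl mult_ac)
  next
    case False
    define s where "s = r + (t - r) div 2"
    have s: "r \<le> s" "s < t" using False less.prems by (auto simp: s_def)
    define g where "g = K_between K s t *v f"
    define N where "N = lp_norm 2 (\<pi> t) f"
    define c where "c = l1_l2_const (t - r)"
    have c: "0 \<le> c" by (simp add: c_def l1_l2_const_nonneg)
    have Kf: "K_between K r t *v f = K_between K r s *v g"
      using s by (simp add: g_def K_between_split[of r s t] matrix_vector_mul_assoc)
    have f2: "lp_norm 1 (\<pi> t) (\<chi> y. (f $ y)\<^sup>2) = N\<^sup>2"
      by (simp add: N_def lp_norm_1 lp_norm_2 pi_nonneg l2_inner_nonneg)
         (simp add: l2_inner_def power2_eq_square)
    have "lp_norm 2 (\<pi> s) (\<chi> y. (g $ y)\<^sup>2) \<le> lp_norm 2 (\<pi> s) (K_between K s t *v (\<chi> y. (f $ y)\<^sup>2))"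
    proof -
      define h where "h = K_between K s t *v (\<chi> y. (f $ y)\<^sup>2)"
      have gh: "(g $ y)\<^sup>2 \<le> h $ y" for y
        unfolding g_def h_def using s by (intro markov_square_le markov_K_between markov) auto
      have "(g $ y)\<^sup>2 * (g $ y)\<^sup>2 \<le> h $ y * h $ y" for y
        by (intro mult_mono gh order_trans[OF zero_le_power2 gh]) simp
      then have "l2_inner (\<pi> s) (\<chi> y. (g $ y)\<^sup>2) (\<chi> y. (g $ y)\<^sup>2) \<le> l2_inner (\<pi> s) h h"
        unfolding l2_inner_def by (intro sum_mono mult_right_mono pi_nonneg) simp
      then show ?thesis by (simp add: lp_norm_2 pi_nonneg h_def)
    qed
    also have "\<dots> \<le> l1_l2_const (t - s) * N\<^sup>2"
      using l1_l2_bound[of s t "\<chi> y. (f $ y)\<^sup>2"] s less.prems by (simp add: f2)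
    also have "\<dots> \<le> 2 powr D * c * N\<^sup>2"
      unfolding c_def by (intro mult_right_mono l1_l2_const_half) (auto simp: s_def)
    finally have g2: "lp_norm 2 (\<pi> s) (\<chi> y. (g $ y)\<^sup>2) \<le> 2 powr D * c * N\<^sup>2" .
    have "((K_between K r t *v f) $ x)\<^sup>2 \<le> (K_between K r s *v (\<chi> y. (g $ y)\<^sup>2)) $ x"
      unfolding Kf using s by (intro markov_square_le markov_K_between markov) auto
    also have "\<dots> \<le> 4 powr D * l1_l2_const (s - r) * lp_norm 2 (\<pi> s) (\<chi> y. (g $ y)\<^sup>2)"
      using less.hyps[of s r "\<chi> y. (g $ y)\<^sup>2" x] s less.prems by linarith
    also have "\<dots> \<le> 4 powr D * (2 powr D * c) * (2 powr D * c * N\<^sup>2)"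
      unfolding c_def
      by (intro mult_mono g2[unfolded c_def] mult_left_mono l1_l2_const_half mult_nonneg_nonneg
          l1_l2_const_nonneg lp_norm_nonneg) (auto simp: s_def)
    also have "\<dots> = (4 powr D * c * N)\<^sup>2"
    proof -
      have "(2::real) powr D * 2 powr D = 4 powr D" by (simp flip: powr_mult)
      then show ?thesis by (simp add: power2_eq_square mult_ac)
    qed
    finally have "\<bar>(K_between K r t *v f) $ x\<bar> \<le> \<bar>4 powr D * c * N\<bar>"
      by (simp only: abs_le_square_iff)
    then show ?thesis using c by (simp add: c_def N_def lp_norm_nonneg)
  qed
qed

end

lemma sum_normalized:
  assumes "0 < mass \<mu>"
  shows "(\<Sum>x\<in>UNIV. normalized \<mu> $ x) = 1"
  using assms by (simp add: normalized_def mass_def flip: sum_divide_distrib)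

lemma l2_centering_le:
  assumes one: "(\<Sum>x\<in>UNIV. \<mu> $ x) = 1" and nonneg: "\<And>x. 0 \<le> \<mu> $ x"
  shows "lp_norm 2 \<mu> (g - vec (expect \<mu> g)) \<le> lp_norm 2 \<mu> g"
proof -
  define m where "m = expect \<mu> g"
  have "l2_inner \<mu> (g - vec m) (g - vec m) = l2_inner \<mu> g g - 2 * m * expect \<mu> g + m\<^sup>2 * (\<Sum>x\<in>UNIV. \<mu> $ x)"
    by (simp add: l2_inner_def expect_def power2_eq_square algebra_simps sum.distrib sum_subtractf
        sum_distrib_left)
  also have "\<dots> \<le> l2_inner \<mu> g g"
    by (simp add: one power2_eq_square flip: m_def)
  finally show ?thesis by (simp add: lp_norm_2 nonneg m_def)
qed

lemma linf_centering_le: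
  fixes g :: "real ^ 'v"
  assumes one: "(\<Sum>x\<in>UNIV. \<mu> $ x) = 1" and nonneg: "\<And>x. 0 \<le> \<mu> $ x" and g: "\<And>x. \<bar>g $ x\<bar> \<le> c"
  shows "linf_norm (g - vec (expect \<mu> g)) \<le> 2 * c"
proof -
  have "\<bar>expect \<mu> g\<bar> \<le> (\<Sum>x\<in>UNIV. c * \<mu> $ x)"
    unfolding expect_def using nonneg g
    by (intro order_trans[OF sum_abs] sum_mono) (simp add: abs_mult mult_right_mono)
  also have "\<dots> = c" by (simp add: one flip: sum_distrib_left)
  finally have m: "\<bar>expect \<mu> g\<bar> \<le> c" .
  have "\<bar>(g - vec (expect \<mu> g)) $ x\<bar> \<le> 2 * c" for x
    using m g[of x] by simp
  then show ?thesis unfolding linf_norm_def by (intro cSUP_least) auto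
qed

theorem theorem3p11:
  fixes K :: "nat \<Rightarrow> real ^ 'v ^ 'v"
    and \<pi> :: "nat \<Rightarrow> real ^ 'v"
    and C D T :: real
    and r t :: nat
  assumes markov: "\<And>s. s \<ge> 1 \<Longrightarrow> markov_operator (K s)"
    and irreducible: "\<And>s. s \<ge> 1 \<Longrightarrow> irreducible_kernel (K s)"
    and aperiodic: "\<And>s. s \<ge> 1 \<Longrightarrow> aperiodic_kernel (K s)"
    and environment: "nondecreasing_environment K \<pi>"
    and pi_0: "\<pi> 0 = \<pi> 1"
    and "T \<ge> 1" and "C > 0" and "D > 0"
    and nash: "\<And>s. s \<ge> 1 \<Longrightarrow>
      nash_inequality C D T (l2_adjoint (normalized (\<pi> s)) (K s) ** K s) (normalized (\<pi> s))"
    and mass_1: "mass (\<pi> 1) \<ge> 1"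
    and "r \<le> t" and "real t \<le> T"
  shows "op_norm (lp_norm 1 (normalized (\<pi> t))) (lp_norm 2 (normalized (\<pi> r)))
           (centered (normalized (\<pi> r)) (K_between K r t))
         \<le> ereal ((C * 2 powr (1 / D) * (1 + 1 / T) * (1 + real_of_int \<lceil>4 * D\<rceil>)
                    / (real t - real r + 1)) powr D
                  * (mass (\<pi> t) / sqrt (mass (\<pi> r))))
       \<and> op_norm (lp_norm 2 (normalized (\<pi> t))) linf_norm
           (centered (normalized (\<pi> r)) (K_between K r t))
         \<le> ereal (2 * (4 * C * 2 powr (1 / D) * (1 + 1 / T) * (1 + real_of_int \<lceil>4 * D\<rceil>)
                        / (real t - real r + 1)) powr D
                  * sqrt (mass (\<pi> t)))"
proof -
  interpret nash_environment K \<pi> C D T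
    by unfold_locales (use assms in auto)
  let ?B = "C * ((1 + 1 / T) * (1 + real_of_int \<lceil>4 * D\<rceil>)) / (real (t - r) + 1)"
  define c where "c = l1_l2_const (t - r)"
  have c: "c = ?B powr D" "0 \<le> c" by (simp_all add: c_def l1_l2_const_def)
  have B: "0 < ?B" using decay_base_pos by simp
  have two: "(2 powr (1 / D)) powr D = (2 :: real)" using \<open>D > 0\<close> by (simp add: powr_powr)
  have const1: "(C * 2 powr (1 / D) * (1 + 1 / T) * (1 + real_of_int \<lceil>4 * D\<rceil>)
      / (real t - real r + 1)) powr D = 2 * c"
  proof -
    have "C * 2 powr (1 / D) * (1 + 1 / T) * (1 + real_of_int \<lceil>4 * D\<rceil>) / (real t - real r + 1)
        = 2 powr (1 / D) * ?B"
      using \<open>r \<le> t\<close> by (simp add: of_nat_diff mult_ac)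
    then show ?thesis using B by (simp only: powr_mult two c(1))
  qed
  have const2: "(4 * C * 2 powr (1 / D) * (1 + 1 / T) * (1 + real_of_int \<lceil>4 * D\<rceil>)
      / (real t - real r + 1)) powr D = 2 * (4 powr D * c)"
  proof -
    have "4 * C * 2 powr (1 / D) * (1 + 1 / T) * (1 + real_of_int \<lceil>4 * D\<rceil>) / (real t - real r + 1)
        = 2 powr (1 / D) * (4 * ?B)"
      using \<open>r \<le> t\<close> by (simp add: of_nat_diff mult_ac)
    then show ?thesis using B by (simp only: powr_mult two c(1))
  qed
  have mass: "0 < mass (\<pi> s)" for s
    using mass_ge_1[of s] by linarith
  have npos: "0 \<le> normalized (\<pi> s) $ x" for s x
    using mass[of s] pi_nonneg[of s x] by (simp add: normalized_def)
  have one: "(\<Sum>x\<in>UNIV. normalized (\<pi> s) $ x) = 1" for s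
    by (rule sum_normalized[OF mass])
  have "lp_norm 2 (normalized (\<pi> r)) (centered (normalized (\<pi> r)) (K_between K r t) f)
      \<le> 2 * c * (mass (\<pi> t) / sqrt (mass (\<pi> r)))"
    if f: "lp_norm 1 (normalized (\<pi> t)) f \<le> 1" for f
  proof -
    have M: "lp_norm 1 (\<pi> t) f \<le> mass (\<pi> t)"
      using f mass[of t] by (simp add: lp_norm_normalized pi_nonneg)
    have "lp_norm 2 (normalized (\<pi> r)) (centered (normalized (\<pi> r)) (K_between K r t) f)
        \<le> lp_norm 2 (normalized (\<pi> r)) (K_between K r t *v f)"
      unfolding centered_def by (intro l2_centering_le one npos)
    also have "\<dots> = lp_norm 2 (\<pi> r) (K_between K r t *v f) / sqrt (mass (\<pi> r))"
      using mass[of r] by (simp add: lp_norm_normalized pi_nonneg powr_half_sqrt)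
    also have "\<dots> \<le> c * mass (\<pi> t) / sqrt (mass (\<pi> r))"
      using order_trans[OF l1_l2_bound[OF \<open>r \<le> t\<close> \<open>real t \<le> T\<close>] mult_left_mono[OF M]] mass[of r] c(2)
      by (intro divide_right_mono) (auto simp: c_def)
    also have "\<dots> \<le> 2 * c * (mass (\<pi> t) / sqrt (mass (\<pi> r)))"
      using c(2) mass[of t] mass[of r] by (simp add: field_simps)
    finally show ?thesis .
  qed
  moreover have "linf_norm (centered (normalized (\<pi> r)) (K_between K r t) f)
      \<le> 2 * (2 * (4 powr D * c)) * sqrt (mass (\<pi> t))"
    if f: "lp_norm 2 (normalized (\<pi> t)) f \<le> 1" for f
  proof -
    have M: "lp_norm 2 (\<pi> t) f \<le> sqrt (mass (\<pi> t))"
      using f mass[of t] by (simp add: lp_norm_normalized pi_nonneg powr_half_sqrt)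
    have "\<bar>(K_between K r t *v f) $ x\<bar> \<le> 4 powr D * c * sqrt (mass (\<pi> t))" for x
      using order_trans[OF l2_linf_bound[OF \<open>r \<le> t\<close> \<open>real t \<le> T\<close>] mult_left_mono[OF M]] c(2)
      by (auto simp: c_def)
    then have "linf_norm (centered (normalized (\<pi> r)) (K_between K r t) f)
        \<le> 2 * (4 powr D * c * sqrt (mass (\<pi> t)))"
      unfolding centered_def by (intro linf_centering_le one npos)
    also have "\<dots> \<le> 2 * (2 * (4 powr D * c)) * sqrt (mass (\<pi> t))"
      using c(2) mass[of t] by simp
    finally show ?thesis .
  qed
  ultimately show ?thesis
    unfolding op_norm_def const1 const2 by (auto intro!: SUP_least)
qed

end
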